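(* Let $s$ be a closed $\omega$-term of type $0$ in normal form and let $u$ be a subterm of $s$. Then there are a $k\in\mathbb{N}$, terms $s_1,\dots,s_k$ of type $0$, and a term $f$ which is either a constant or a zero $(t_n)_{n\in\mathbb{N}}$, such that $u=fs_1\cdots s_k$ (and thus $s_1,\dots,s_k$ are also in normal form).
   Context: $\sigma_{\mathrm{ar}}$ is the signature with constant $0$, unary function symbol $S$, binary relation symbol $<$, and function symbols for all primitive recursive functions; $\sigma$ is a fixed signature containing $\sigma_{\mathrm{ar}}$. A first-order $\sigma$-formula is called quantifier-free if all its quantifiers are bounded (of the form $\forall x\le t$ or $\exists x\le t$, with $x$ not occurring in $t$). Finite types are generated from $0$ by the binary operation $\to$. Write $0^0\to0:=0$ and $0^{n+1}\to0:=0\to(0^n\to0)$. The $\omega$-terms (possibly infinite, well-founded) are defined inductively: countably many variables of each type; for each $n$-ary function symbol $f$ of $\sigma$ that is not a primitive recursive function symbol, a constant $f$ of type $0^n\to0$ ($0$ and $S$ are kept as such constants); for each quantifier-free $\sigma$-formula $\varphi$ containing symbols not in $\sigma_{\mathrm{ar}}$, with $m$ free variables, a constant $c_\varphi$ of type $0^{m+2}\to0$; $\lambda x.t$ of type $\rho\to\tau$ for $x$ a variable of type $\rho$ and $t$ of type $\tau$; $ts$ of type $\tau$ for $t$ of type $\rho\to\tau$ and $s$ of type $\rho$; and, if $t_n$ is a term of type $\rho$ for each $n\in\mathbb{N}$, the term $(t_n)_{n\in\mathbb{N}}$ of type $0\to\rho$, called zero if $\rho=0$ and non-zero otherwise. $\underline{m}:=S\cdots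 S0$ ($m$ times). The subterms of a term are the term itself and the subterms of its immediate constituents (including all the components $t_n$ of $(t_n)_{n\in\mathbb{N}}$). Application associates to the left. The reductions, applicable to any subterm, are $(\lambda x.t)s\leadsto t[x:=s]$, $((t_n)_{n\in\mathbb{N}}r)s\leadsto((t_ns)_{n\in\mathbb{N}})r$, $(t_n)_{n\in\mathbb{N}}\underline{m}\leadsto t_m$. A term is in normal form if no subterm of it is of the form of a left-hand side. A term is closed if it has no free variables. *)

theory Defs
  imports Main
begin

text \<open>An \<open>n\<close>-ary function on the naturals is represented as a function on lists that is
  \<open>0\<close> on all lists of length other than \<open>n\<close>, so that the representation is unique.\<close>

definition on_length :: "nat \<Rightarrow> (nat list \<Rightarrow> nat) \<Rightarrow> nat list \<Rightarrow> nat" where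
  "on_length n f = (\<lambda>xs. if length xs = n then f xs else 0)"

inductive prim_rec :: "nat \<Rightarrow> (nat list \<Rightarrow> nat) \<Rightarrow> bool" where
  zero: "prim_rec n (on_length n (\<lambda>_. 0))"
| succ: "prim_rec 1 (on_length 1 (\<lambda>xs. Suc (hd xs)))"
| proj: "i < n \<Longrightarrow> prim_rec n (on_length n (\<lambda>xs. xs ! i))"
| comp: "prim_rec (length gs) f \<Longrightarrow> \<forall>g\<in>set gs. prim_rec n g \<Longrightarrow>
    prim_rec n (on_length n (\<lambda>xs. f (map (\<lambda>g. g xs) gs)))"
| rec: "prim_rec n g \<Longrightarrow> prim_rec (n + 2) h \<Longrightarrow>
    prim_rec (Suc n) (on_length (Suc n)
      (\<lambda>xs. rec_nat (g (tl xs)) (\<lambda>m r. h (m # r # tl xs)) (hd xs)))"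

text \<open>The signature \<open>\<sigma>\<close> is the arithmetical signature (\<open>Zero\<close>, \<open>Succ\<close>, \<open>PR\<close>, \<open>Less\<close>) together
  with further symbols from the types \<open>'f\<close> and \<open>'r\<close>; \<open>PR n f\<close> is the symbol for the primitive
  recursive \<open>n\<close>-ary function \<open>f\<close>. The additional symbols are given with their arities as partial
  functions, so that there may be none at all.\<close>

datatype 'f fsym = Zero | Succ | PR nat "nat list \<Rightarrow> nat" | ExtraF 'f

datatype 'r rsym = Less | ExtraR 'r

record ('f, 'r) signature =
  extra_fun_arity :: "'f \<Rightarrow> nat option"
  extra_rel_arity :: "'r \<Rightarrow> nat option"

fun fun_arity :: "('f, 'r) signature \<Rightarrow> 'f fsym \<Rightarrow> nat option" where
  "fun_arity \<sigma> Zero = Some 0"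
| "fun_arity \<sigma> Succ = Some 1"
| "fun_arity \<sigma> (PR n f) = (if prim_rec n f then Some n else None)"
| "fun_arity \<sigma> (ExtraF f) = extra_fun_arity \<sigma> f"

fun rel_arity :: "('f, 'r) signature \<Rightarrow> 'r rsym \<Rightarrow> nat option" where
  "rel_arity \<sigma> Less = Some 2"
| "rel_arity \<sigma> (ExtraR r) = extra_rel_arity \<sigma> r"

datatype 'f tm = V nat | Fn "'f fsym" "'f tm list"

text \<open>\<open>BAll x t \<phi>\<close> and \<open>BEx x t \<phi>\<close> are the bounded quantifications \<open>\<forall>x\<le>t. \<phi>\<close> and \<open>\<exists>x\<le>t. \<phi>\<close>.\<close>

datatype ('f, 'r) fm =
    Eq "'f tm" "'f tm"
  | Rel "'r rsym" "'f tm list"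
  | Neg "('f, 'r) fm"
  | Conj "('f, 'r) fm" "('f, 'r) fm"
  | Disj "('f, 'r) fm" "('f, 'r) fm"
  | Imp "('f, 'r) fm" "('f, 'r) fm"
  | All nat "('f, 'r) fm"
  | Ex nat "('f, 'r) fm"
  | BAll nat "'f tm" "('f, 'r) fm"
  | BEx nat "'f tm" "('f, 'r) fm"

fun wf_tm :: "('f, 'r) signature \<Rightarrow> 'f tm \<Rightarrow> bool" where
  "wf_tm \<sigma> (V x) \<longleftrightarrow> True"
| "wf_tm \<sigma> (Fn f ts) \<longleftrightarrow> fun_arity \<sigma> f = Some (length ts) \<and> (\<forall>t\<in>set ts. wf_tm \<sigma> t)"

fun vars_tm :: "'f tm \<Rightarrow> nat set" where
  "vars_tm (V x) = {x}"
| "vars_tm (Fn f ts) = (\<Union>t\<in>set ts. vars_tm t)"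

fun wf_fm :: "('f, 'r) signature \<Rightarrow> ('f, 'r) fm \<Rightarrow> bool" where
  "wf_fm \<sigma> (Eq s t) \<longleftrightarrow> wf_tm \<sigma> s \<and> wf_tm \<sigma> t"
| "wf_fm \<sigma> (Rel r ts) \<longleftrightarrow> rel_arity \<sigma> r = Some (length ts) \<and> (\<forall>t\<in>set ts. wf_tm \<sigma> t)"
| "wf_fm \<sigma> (Neg \<phi>) \<longleftrightarrow> wf_fm \<sigma> \<phi>"
| "wf_fm \<sigma> (Conj \<phi> \<psi>) \<longleftrightarrow> wf_fm \<sigma> \<phi> \<and> wf_fm \<sigma> \<psi>"
| "wf_fm \<sigma> (Disj \<phi> \<psi>) \<longleftrightarrow> wf_fm \<sigma> \<phi> \<and> wf_fm \<sigma> \<psi>"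
| "wf_fm \<sigma> (Imp \<phi> \<psi>) \<longleftrightarrow> wf_fm \<sigma> \<phi> \<and> wf_fm \<sigma> \<psi>"
| "wf_fm \<sigma> (All x \<phi>) \<longleftrightarrow> wf_fm \<sigma> \<phi>"
| "wf_fm \<sigma> (Ex x \<phi>) \<longleftrightarrow> wf_fm \<sigma> \<phi>"
| "wf_fm \<sigma> (BAll x t \<phi>) \<longleftrightarrow> wf_tm \<sigma> t \<and> x \<notin> vars_tm t \<and> wf_fm \<sigma> \<phi>"
| "wf_fm \<sigma> (BEx x t \<phi>) \<longleftrightarrow> wf_tm \<sigma> t \<and> x \<notin> vars_tm t \<and> wf_fm \<sigma> \<phi>"

fun quantifier_free :: "('f, 'r) fm \<Rightarrow> bool" where
  "quantifier_free (Eq s t) \<longleftrightarrow> True"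
| "quantifier_free (Rel r ts) \<longleftrightarrow> True"
| "quantifier_free (Neg \<phi>) \<longleftrightarrow> quantifier_free \<phi>"
| "quantifier_free (Conj \<phi> \<psi>) \<longleftrightarrow> quantifier_free \<phi> \<and> quantifier_free \<psi>"
| "quantifier_free (Disj \<phi> \<psi>) \<longleftrightarrow> quantifier_free \<phi> \<and> quantifier_free \<psi>"
| "quantifier_free (Imp \<phi> \<psi>) \<longleftrightarrow> quantifier_free \<phi> \<and> quantifier_free \<psi>"
| "quantifier_free (All x \<phi>) \<longleftrightarrow> False"
| "quantifier_free (Ex x \<phi>) \<longleftrightarrow> False"
| "quantifier_free (BAll x t \<phi>) \<longleftrightarrow> quantifier_free \<phi>"
| "quantifier_free (BEx x t \<phi>) \<longleftrightarrow> quantifier_free \<phi>"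

fun fv_fm :: "('f, 'r) fm \<Rightarrow> nat set" where
  "fv_fm (Eq s t) = vars_tm s \<union> vars_tm t"
| "fv_fm (Rel r ts) = (\<Union>t\<in>set ts. vars_tm t)"
| "fv_fm (Neg \<phi>) = fv_fm \<phi>"
| "fv_fm (Conj \<phi> \<psi>) = fv_fm \<phi> \<union> fv_fm \<psi>"
| "fv_fm (Disj \<phi> \<psi>) = fv_fm \<phi> \<union> fv_fm \<psi>"
| "fv_fm (Imp \<phi> \<psi>) = fv_fm \<phi> \<union> fv_fm \<psi>"
| "fv_fm (All x \<phi>) = fv_fm \<phi> - {x}"
| "fv_fm (Ex x \<phi>) = fv_fm \<phi> - {x}"
| "fv_fm (BAll x t \<phi>) = vars_tm t \<union> (fv_fm \<phi> - {x})"
| "fv_fm (BEx x t \<phi>) = vars_tm t \<union> (fv_fm \<phi> - {x})"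

text \<open>The sets generated by the datatype package collect exactly the occurring symbols
  that are not in the arithmetical signature.\<close>

definition has_extra_symbol :: "('f, 'r) fm \<Rightarrow> bool" where
  "has_extra_symbol \<phi> \<longleftrightarrow> set1_fm \<phi> \<noteq> {} \<or> set2_fm \<phi> \<noteq> {}"

datatype ty = Base | Arrow ty ty  (infixr \<open>\<rightarrow>\<close> 60)

text \<open>\<open>fun_ty n\<close> is the type \<open>0\<^sup>n \<rightarrow> 0\<close>.\<close>

primrec fun_ty :: "nat \<Rightarrow> ty" where
  "fun_ty 0 = Base"
| "fun_ty (Suc n) = Base \<rightarrow> fun_ty n"

datatype ('f, 'r) const = FunC "'f fsym" | FmC "('f, 'r) fm"

text \<open>Raw terms; the \<open>\<omega>\<close>-terms are the typable ones. Variables carry their type, and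
  \<open>Seq t\<close> is the term \<open>(t\<^sub>n)\<^sub>n\<close>.\<close>

datatype ('f, 'r) trm =
    Var nat ty
  | Const "('f, 'r) const"
  | Lam nat ty "('f, 'r) trm"
  | App "('f, 'r) trm" "('f, 'r) trm"
  | Seq "nat \<Rightarrow> ('f, 'r) trm"

inductive const_type :: "('f, 'r) signature \<Rightarrow> ('f, 'r) const \<Rightarrow> ty \<Rightarrow> bool" for \<sigma> where
  fun_symbol: "(\<forall>m g. f \<noteq> PR m g) \<Longrightarrow> fun_arity \<sigma> f = Some n \<Longrightarrow>
    const_type \<sigma> (FunC f) (fun_ty n)"
| formula: "wf_fm \<sigma> \<phi> \<Longrightarrow> quantifier_free \<phi> \<Longrightarrow> has_extra_symbol \<phi> \<Longrightarrow>
    const_type \<sigma> (FmC \<phi>) (fun_ty (card (fv_fm \<phi>) + 2))"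

inductive omega_term :: "('f, 'r) signature \<Rightarrow> ('f, 'r) trm \<Rightarrow> ty \<Rightarrow> bool" for \<sigma> where
  var: "omega_term \<sigma> (Var x \<rho>) \<rho>"
| const: "const_type \<sigma> c \<rho> \<Longrightarrow> omega_term \<sigma> (Const c) \<rho>"
| lam: "omega_term \<sigma> t \<tau> \<Longrightarrow> omega_term \<sigma> (Lam x \<rho> t) (\<rho> \<rightarrow> \<tau>)"
| app: "omega_term \<sigma> t (\<rho> \<rightarrow> \<tau>) \<Longrightarrow> omega_term \<sigma> s \<rho> \<Longrightarrow> omega_term \<sigma> (App t s) \<tau>"
| seq: "(\<And>n. omega_term \<sigma> (t n) \<rho>) \<Longrightarrow> omega_term \<sigma> (Seq t) (Base \<rightarrow> \<rho>)"

definition is_constant :: "('f, 'r) signature \<Rightarrow> ('f, 'r) trm \<Rightarrow> bool" where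
  "is_constant \<sigma> f \<longleftrightarrow> (\<exists>c \<rho>. f = Const c \<and> const_type \<sigma> c \<rho>)"

definition is_zero_seq :: "('f, 'r) signature \<Rightarrow> ('f, 'r) trm \<Rightarrow> bool" where
  "is_zero_seq \<sigma> f \<longleftrightarrow> (\<exists>t. f = Seq t \<and> (\<forall>n. omega_term \<sigma> (t n) Base))"

primrec free_vars :: "('f, 'r) trm \<Rightarrow> (nat \<times> ty) set" where
  "free_vars (Var x \<rho>) = {(x, \<rho>)}"
| "free_vars (Const c) = {}"
| "free_vars (Lam x \<rho> t) = free_vars t - {(x, \<rho>)}"
| "free_vars (App t s) = free_vars t \<union> free_vars s"
| "free_vars (Seq t) = (\<Union>n. free_vars (t n))"

definition closed_term :: "('f, 'r) trm \<Rightarrow> bool" where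
  "closed_term t \<longleftrightarrow> free_vars t = {}"

inductive subterm :: "('f, 'r) trm \<Rightarrow> ('f, 'r) trm \<Rightarrow> bool" where
  refl: "subterm t t"
| lam: "subterm u t \<Longrightarrow> subterm u (Lam x \<rho> t)"
| app_left: "subterm u t \<Longrightarrow> subterm u (App t s)"
| app_right: "subterm u s \<Longrightarrow> subterm u (App t s)"
| seq: "subterm u (t n) \<Longrightarrow> subterm u (Seq t)"

primrec num :: "nat \<Rightarrow> ('f, 'r) trm" where
  "num 0 = Const (FunC Zero)"
| "num (Suc m) = App (Const (FunC Succ)) (num m)"

text \<open>The left-hand sides of the reductions \<open>(\<lambda>x. t) s \<leadsto> t[x := s]\<close>,
  \<open>((t\<^sub>n)\<^sub>n r) s \<leadsto> ((t\<^sub>n s)\<^sub>n) r\<close> and \<open>(t\<^sub>n)\<^sub>n (num m) \<leadsto> t\<^sub>m\<close>.\<close>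

inductive redex :: "('f, 'r) trm \<Rightarrow> bool" where
  beta: "redex (App (Lam x \<rho> t) s)"
| permute: "redex (App (App (Seq t) r) s)"
| select: "redex (App (Seq t) (num m))"

definition normal :: "('f, 'r) trm \<Rightarrow> bool" where
  "normal t \<longleftrightarrow> (\<forall>u. subterm u t \<longrightarrow> \<not> redex u)"

abbreviation apps :: "('f, 'r) trm \<Rightarrow> ('f, 'r) trm list \<Rightarrow> ('f, 'r) trm" where
  "apps f ss \<equiv> foldl App f ss"

end

theory Submission
  imports Defs
begin

text \<open>A closed normal term of type \<open>0\<close> is a head applied to arguments. The head is not a variable,
  not an abstraction, and not a non-zero \<open>(t\<^sub>n)\<^sub>n\<close>, since that would need at least two arguments
  to reach type \<open>0\<close> and so give a permutation redex; hence every argument has type \<open>0\<close>. Consequently the closed normal terms of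
  the required shape are closed under passing to immediate subterms: these are a shorter
  application, an argument, or a component of a zero sequence, the latter two again being closed,
  normal and of type \<open>0\<close>.\<close>

inductive spine :: "('f, 'r) signature \<Rightarrow> ('f, 'r) trm \<Rightarrow> bool" for \<sigma> where
  const: "const_type \<sigma> c \<rho> \<Longrightarrow> spine \<sigma> (Const c)"
| zero_seq: "(\<And>n. omega_term \<sigma> (t n) Base) \<Longrightarrow> spine \<sigma> (Seq t)"
| app: "spine \<sigma> t \<Longrightarrow> omega_term \<sigma> s Base \<Longrightarrow> spine \<sigma> (App t s)"

inductive_cases spine_LamE: "spine \<sigma> (Lam x \<rho> t)"
inductive_cases spine_AppE: "spine \<sigma> (App t s)"
inductive_cases spine_SeqE: "spine \<sigma> (Seq t)"

lemma normal_not_redex: "normal t \<Longrightarrow> \<not> redex t"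
  by (auto simp: normal_def intro: subterm.refl)

lemma normal_App:
  assumes "normal (App t s)"
  shows "normal t" "normal s"
  using assms by (auto simp: normal_def intro: subterm.app_left subterm.app_right)

lemma normal_Seq: "normal (Seq t) \<Longrightarrow> normal (t n)"
  by (auto simp: normal_def intro: subterm.seq)

lemma closed_App:
  assumes "closed_term (App t s)"
  shows "closed_term t" "closed_term s"
  using assms by (auto simp: closed_term_def)

lemma closed_Seq: "closed_term (Seq t) \<Longrightarrow> closed_term (t n)"
  by (auto simp: closed_term_def)

text \<open>Applied to the type of the function part, this forces the argument to have type
  \<open>Base\<close> and keeps the result type of the form \<open>fun_ty m\<close>.\<close>

lemma fun_ty_eq_Arrow: "\<rho> \<rightarrow> \<tau> = fun_ty n \<Longrightarrow> \<rho> = Base \<and> (\<exists>m. \<tau> = fun_ty m)"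
  by (cases n) auto

lemma const_type_fun_ty: "const_type \<sigma> c \<rho> \<Longrightarrow> \<exists>n. \<rho> = fun_ty n"
  by (auto elim: const_type.cases)

text \<open>Function parts of applications have arrow types, so the induction on typing needs a
  claim at every type. Each of the last three alternatives excludes \<open>Base\<close>.\<close>

lemma closed_normal_cases:
  assumes "omega_term \<sigma> t \<rho>" "closed_term t" "normal t"
  shows "(spine \<sigma> t \<and> (\<exists>n. \<rho> = fun_ty n)) \<or>
    (\<rho> \<noteq> Base \<and> (\<exists>x \<tau> b. t = Lam x \<tau> b)) \<or>
    (\<exists>a \<tau>. t = Seq a \<and> \<rho> = Base \<rightarrow> \<tau> \<and> \<tau> \<noteq> Base) \<or>
    (\<rho> \<noteq> Base \<and> (\<exists>a r. t = App (Seq a) r))"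
  using assms
proof (induction rule: omega_term.induct)
  case (var x \<rho>)
  then show ?case by (simp add: closed_term_def)
next
  case (const c \<rho>)
  then show ?case by (auto intro: spine.const dest: const_type_fun_ty)
next
  \<comment> \<open>The body may be open, so the induction hypothesis is out of reach, but the arrow
    type alone suffices.\<close>
  case (lam t \<tau> x \<rho>)
  then show ?case by simp
next
  case (app t \<rho> \<tau> s)
  \<comment> \<open>These shapes of \<open>t\<close> would make \<open>App t s\<close> a
    \<open>beta\<close> or a \<open>permute\<close> redex.\<close>
  have "\<nexists>x \<rho> b. t = Lam x \<rho> b" and "\<nexists>a r. t = App (Seq a) r"
    using normal_not_redex[OF app.prems(2)] by (auto intro: redex.intros)
  \<comment> \<open>For a non-zero sequence, \<open>\<tau>\<close> is the type of its components, so
    the application falls under the fourth alternative.\<close>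
  then consider "spine \<sigma> t" "\<exists>n. \<rho> \<rightarrow> \<tau> = fun_ty n" | a where "t = Seq a" "\<tau> \<noteq> Base"
    using app.IH(1) closed_App(1)[OF app.prems(1)] normal_App(1)[OF app.prems(2)] by auto
  then show ?case
  proof cases
    case 1
    then show ?thesis
      using app.hyps(2) by (auto dest: fun_ty_eq_Arrow intro: spine.app)
  next
    case 2
    then show ?thesis by simp
  qed
next
  case (seq t \<rho>)
  show ?case
  proof (cases "\<rho> = Base")
    case True
    then have "Base \<rightarrow> \<rho> = fun_ty 1" by simp
    then show ?thesis using True seq.hyps by (blast intro: spine.zero_seq)
  next
    case False
    then show ?thesis by simp
  qed
qed

lemma spine_of_Base:
  "omega_term \<sigma> t Base \<Longrightarrow> closed_term t \<Longrightarrow> normal t \<Longrightarrow> spine \<sigma> t"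
  using closed_normal_cases by blast

text \<open>A function part need not have type \<open>Base\<close>, so it inherits
  \<open>spine\<close> by inversion. Arguments and components have type \<open>Base\<close> and are
  handled by \<open>spine_of_Base\<close>; they stay closed because a spine never enters an
  abstraction.\<close>

lemma spine_subterm:
  "subterm u t \<Longrightarrow> spine \<sigma> t \<Longrightarrow> closed_term t \<Longrightarrow> normal t \<Longrightarrow> spine \<sigma> u \<and> normal u"
proof (induction rule: subterm.induct)
  case (refl t)
  then show ?case by simp
next
  case (lam u t x \<rho>)
  then show ?case by (blast elim: spine_LamE)
next
  case (app_left u t s)
  then show ?case by (blast elim: spine_AppE dest: closed_App normal_App)
next
  case (app_right u s t)
  then show ?case by (blast elim: spine_AppE dest: closed_App normal_App spine_of_Base)
next
  case (seq u t n)
  then show ?case by (blast elim: spine_SeqE dest: closed_Seq normal_Seq spine_of_Base)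
qed

lemma spine_apps:
  "spine \<sigma> t \<Longrightarrow> normal t \<Longrightarrow> \<exists>f ss. (\<forall>s\<in>set ss. omega_term \<sigma> s Base \<and> normal s) \<and>
    (is_constant \<sigma> f \<or> is_zero_seq \<sigma> f) \<and> t = apps f ss"
proof (induction rule: spine.induct)
  case (const c \<rho>)
  then have "is_constant \<sigma> (Const c)" by (auto simp: is_constant_def)
  then show ?case by (intro exI[of _ "Const c"] exI[of _ "[]"]) simp
next
  case (zero_seq t)
  then have "is_zero_seq \<sigma> (Seq t)" by (auto simp: is_zero_seq_def)
  then show ?case by (intro exI[of _ "Seq t"] exI[of _ "[]"]) simp
next
  case (app t s)
  then obtain f ss where "\<forall>s\<in>set ss. omega_term \<sigma> s Base \<and> normal s"
    "is_constant \<sigma> f \<or> is_zero_seq \<sigma> f" "t = apps f ss"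
    by (blast dest: normal_App)
  \<comment> \<open>Application associates to the left, so the outermost argument comes last in the
    list.\<close>
  then show ?case using app.hyps(2) normal_App(2)[OF app.prems]
    by (intro exI[of _ f] exI[of _ "ss @ [s]"]) auto
qed

theorem lemma2p5:
  fixes \<sigma> :: "('f, 'r) signature" and s u :: "('f, 'r) trm"
  assumes "omega_term \<sigma> s Base"
    and "closed_term s"
    and "normal s"
    and "subterm u s"
  shows "\<exists>(k :: nat) f ss. length ss = k \<and>
    (\<forall>t\<in>set ss. omega_term \<sigma> t Base \<and> normal t) \<and>
    (is_constant \<sigma> f \<or> is_zero_seq \<sigma> f) \<and>
    u = apps f ss"
proof -
  have "spine \<sigma> u \<and> normal u"
    using spine_subterm[OF assms(4) spine_of_Base[OF assms(1-3)] assms(2,3)] .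
  then show ?thesis using spine_apps by blast
qed

end
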